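(* Let $k$ balls be dropped independently and uniformly into $n$ boxes, and let $W$ be the number of triples of balls sharing a box. Then $$\left\|\mathcal{L}(W) - \mathrm{Poi}_{\binom{k}{3}\frac{1}{n^2}}\right\|_{TV} = O\left(\frac{k^4}{n^3}\right),$$ i.e. there is an absolute constant $C$ such that the left side is at most $C k^4/n^3$ for all positive integers $k,n$. In particular, if $\theta>0$ is fixed and $k = \lfloor \theta n^{2/3} \rfloor$, then as $n \to \infty$ the random variable $W$ has a non-trivial limiting Poisson distribution (with mean $\lim_{n\to\infty} \binom{k}{3}\frac{1}{n^2} = \theta^3/6$).
   Context: If ball $i$ is placed in box $b_i$ (the $b_i$ being i.i.d. uniform on $\{1,\ldots,n\}$), then $W = |\{(i,j,l) : 1 \le i<j<l\le k,\ b_i=b_j=b_l\}|$. $\mathcal{L}(W)$ denotes the law of $W$ and $\mathrm{Poi}_\lambda$ the Poisson distribution with mean $\lambda$ ($\mathrm{Poi}_0$ is the point mass at $0$). The total variation distance is $\|\mu-\nu\|_{TV} = \sup_A |\mu(A)-\nu(A)|$, the supremum being over all measurable sets $A$. *)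

theory Defs
  imports "HOL-Probability.Probability"
begin

text \<open>Ball \<^term>\<open>i\<close> falls into box \<^term>\<open>b i\<close>; balls are numbered from 1 to \<^term>\<open>k\<close>
  and boxes from 1 to \<^term>\<open>n\<close>. Outside \<^term>\<open>{1..k}\<close> the value of \<^term>\<open>b\<close> is irrelevant.\<close>

definition ball_drop :: "nat \<Rightarrow> nat \<Rightarrow> (nat \<Rightarrow> nat) pmf" where
  "ball_drop k n = Pi_pmf {1..k} undefined (\<lambda>_. pmf_of_set {1..n})"

definition triples :: "nat \<Rightarrow> (nat \<Rightarrow> nat) \<Rightarrow> nat" where
  "triples k b =
     card {(i, j, l). 1 \<le> i \<and> i < j \<and> j < l \<and> l \<le> k \<and> b i = b j \<and> b j = b l}"

definition triples_law :: "nat \<Rightarrow> nat \<Rightarrow> nat pmf" where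
  "triples_law k n = map_pmf (triples k) (ball_drop k n)"

text \<open>The library's \<^const>\<open>poisson_pmf\<close> is specified only for a positive rate.\<close>

definition Poi :: "real \<Rightarrow> nat pmf" where
  "Poi r = (if r = 0 then return_pmf 0 else poisson_pmf r)"

text \<open>Intended for probability measures with the same measurable sets; the supremum is then
  taken over a nonempty set of reals bounded by 1.\<close>

definition tv_dist :: "'a measure \<Rightarrow> 'a measure \<Rightarrow> real" where
  "tv_dist M N = (SUP A\<in>sets M. \<bar>measure M A - measure N A\<bar>)"

text \<open>The library's notion of weak convergence, \<^const>\<open>weak_conv_m\<close>, is for measures on the real
  line, so laws on the natural numbers are transported there.\<close>

definition real_law :: "nat pmf \<Rightarrow> real measure" where
  "real_law p = distr (measure_pmf p) borel real"

end

theory Submission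
  imports Defs "HOL-Real_Asymp.Real_Asymp"
begin

text \<open>The bound is an instance of the Chen--Stein method. The solution \<open>g\<close> of the Stein
  equation for \<open>Poi r\<close> is 1-Lipschitz, whatever the rate \<open>r\<close>. Write \<open>W\<close> as a sum of indicators
  \<open>X S\<close> over the triples \<open>S\<close> of balls; \<open>X S\<close> is independent of the number of monochromatic
  triples disjoint from \<open>S\<close>, so the error is at most the sum, over intersecting pairs \<open>S\<close>, \<open>R\<close>
  of triples, of \<open>E (X S * X R)\<close> (for \<open>S \<noteq> R\<close>) and of \<open>E (X S) * E (X R)\<close>. The pairs sharing
  two balls contribute order \<open>k^4 / n^3\<close> and all others order \<open>k^5 / n^4\<close>, which is no larger when
  \<open>k \<le> n\<close>; when \<open>k > n\<close> the claimed bound exceeds 1.\<close>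

section \<open>The Stein equation of the Poisson distribution\<close>

text \<open>Detailed balance for the chain on the naturals that steps up at rate \<open>r\<close>
  and down from \<open>i\<close> at rate \<open>i\<close>. Both tail bounds and the Stein equation
  below rest on it.\<close>

lemma poisson_pmf_Suc:
  assumes "0 < r"
  shows "real (Suc i) * pmf (poisson_pmf r) (Suc i) = r * pmf (poisson_pmf r) i"
  using assms by (simp add: pmf_poisson [OF assms] del: of_nat_Suc)

lemma sums_measure_pmf_atLeast:
  fixes p :: "nat pmf"
  shows "(\<lambda>m. pmf p (m + i)) sums measure p {i..}"
proof -
  have "(\<lambda>m. measure p {m + i}) sums measure p (\<Union>m. {m + i})"
    by (rule measure_pmf.finite_measure_UNION) (auto simp: disjoint_family_on_def)
  moreover have "(\<Union>m. {m + i}) = {i..}"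
    by (auto simp: nat_le_iff_add)
  ultimately show ?thesis
    by (simp add: measure_pmf_single)
qed

text \<open>Detailed balance term by term, the factor \<open>i\<close> being at most the index of
  every term of the tail. Together with its mirror image \<open>poisson_lower_tail\<close> it fixes
  the signs in \<open>stein_sol_increment_le\<close>.\<close>

lemma poisson_upper_tail:
  assumes r: "0 < r"
  shows "real i * measure (poisson_pmf r) {i<..} \<le> r * measure (poisson_pmf r) {i..}"
proof (rule sums_le)
  show "(\<lambda>m. real i * pmf (poisson_pmf r) (m + Suc i)) sums (real i * measure (poisson_pmf r) {i<..})"
    unfolding atLeast_Suc_greaterThan [symmetric] by (intro sums_mult sums_measure_pmf_atLeast)
  show "(\<lambda>m. r * pmf (poisson_pmf r) (m + i)) sums (r * measure (poisson_pmf r) {i..})"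
    by (intro sums_mult sums_measure_pmf_atLeast)
  fix m
  have "real i * pmf (poisson_pmf r) (m + Suc i) \<le> real (Suc (m + i)) * pmf (poisson_pmf r) (Suc (m + i))"
    unfolding add_Suc_right by (intro mult_right_mono) auto
  also have "\<dots> = r * pmf (poisson_pmf r) (m + i)"
    by (rule poisson_pmf_Suc [OF r])
  finally show "real i * pmf (poisson_pmf r) (m + Suc i) \<le> r * pmf (poisson_pmf r) (m + i)" .
qed

lemma poisson_lower_tail:
  assumes r: "0 < r"
  shows "r * measure (poisson_pmf r) {..<i} \<le> real i * measure (poisson_pmf r) {..i}"
proof -
  have "r * measure (poisson_pmf r) {..<i} = (\<Sum>m<i. r * pmf (poisson_pmf r) m)"
    by (simp add: measure_measure_pmf_finite sum_distrib_left del: pmf_poisson)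
  also have "\<dots> = (\<Sum>m<i. real (Suc m) * pmf (poisson_pmf r) (Suc m))"
    by (simp only: poisson_pmf_Suc [OF r])
  also have "\<dots> \<le> (\<Sum>m<i. real i * pmf (poisson_pmf r) (Suc m))"
    by (intro sum_mono mult_right_mono) auto
  also have "\<dots> = real i * (\<Sum>m\<in>Suc ` {..<i}. pmf (poisson_pmf r) m)"
    by (subst sum.reindex) (simp_all add: sum_distrib_left del: pmf_poisson)
  also have "\<dots> \<le> real i * (\<Sum>m\<le>i. pmf (poisson_pmf r) m)"
    by (intro mult_left_mono sum_mono2) auto
  also have "\<dots> = real i * measure (poisson_pmf r) {..i}"
    by (simp add: measure_measure_pmf_finite del: pmf_poisson)
  finally show ?thesis .
qed

text \<open>The index is shifted by one against the usual solution \<open>f\<close> of the Stein equation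
  \<open>r * f (i + 1) - i * f i = indicator A i - Poi r A\<close>: this is \<open>f (i + 1)\<close>, so that the
  irrelevant value \<open>f 0\<close> does not appear.\<close>

definition stein_sol :: "real \<Rightarrow> nat set \<Rightarrow> nat \<Rightarrow> real" where
  "stein_sol r A i =
     (measure (poisson_pmf r) (A \<inter> {..i}) - measure (poisson_pmf r) A * measure (poisson_pmf r) {..i})
       / (r * pmf (poisson_pmf r) i)"

text \<open>By detailed balance both terms on the left acquire the denominator
  \<open>pmf (poisson_pmf r) i\<close>, and their numerators differ by the contribution of the
  single point \<open>i\<close>. At \<open>i = 0\<close> the truncated \<open>i - 1\<close> is
  harmless, being multiplied by 0.\<close>

lemma stein_equation:
  assumes r: "0 < r"
  shows "r * stein_sol r A i - real i * stein_sol r A (i - 1) = indicator A i - measure (poisson_pmf r) A"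
proof -
  let ?P = "measure_pmf (poisson_pmf r)"
  have pos: "0 < pmf (poisson_pmf r) i" for i using r by simp
  show ?thesis
  proof (cases i)
    case 0
    have "measure ?P (A \<inter> {..0}) = indicator A 0 * pmf (poisson_pmf r) 0"
      by (cases "0 \<in> A") (simp_all add: measure_pmf_single del: pmf_poisson)
    moreover have "measure ?P {..0} = pmf (poisson_pmf r) 0"
      by (simp add: measure_pmf_single del: pmf_poisson)
    ultimately show ?thesis
      using r pos[of 0] 0 by (simp add: stein_sol_def field_simps del: pmf_poisson)
  next
    case (Suc j)
    have "measure ?P (A \<inter> {..i}) = measure ?P (A \<inter> {..j} \<union> A \<inter> {i})"
      using Suc by (intro arg_cong [where f = "measure ?P"]) (auto simp: le_Suc_eq)
    also have "\<dots> = measure ?P (A \<inter> {..j}) + measure ?P (A \<inter> {i})"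
      using Suc by (intro measure_pmf.finite_measure_Union) auto
    also have "measure ?P (A \<inter> {i}) = indicator A i * pmf (poisson_pmf r) i"
      by (cases "i \<in> A") (simp_all add: measure_pmf_single del: pmf_poisson)
    finally have A: "measure ?P (A \<inter> {..i}) = measure ?P (A \<inter> {..j}) + indicator A i * pmf (poisson_pmf r) i" .
    have "{..i} = {..j} \<union> {i}" using Suc by auto
    then have "measure ?P {..i} = measure ?P {..j} + measure ?P {i}"
      using Suc by (simp only:) (intro measure_pmf.finite_measure_Union, auto)
    then have U: "measure ?P {..i} = measure ?P {..j} + pmf (poisson_pmf r) i"
      by (simp add: measure_pmf_single del: pmf_poisson)
    have p: "r * pmf (poisson_pmf r) j = real i * pmf (poisson_pmf r) i"
      using poisson_pmf_Suc [OF r, of j] Suc by (simp del: pmf_poisson)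
    have "r * stein_sol r A i = (measure ?P (A \<inter> {..i}) - measure ?P A * measure ?P {..i}) / pmf (poisson_pmf r) i"
      using r by (simp add: stein_sol_def del: pmf_poisson)
    moreover have "real i * stein_sol r A (i - 1) =
        (measure ?P (A \<inter> {..j}) - measure ?P A * measure ?P {..j}) / pmf (poisson_pmf r) i"
      using Suc unfolding stein_sol_def diff_Suc_1 Suc p[unfolded Suc] by (simp del: pmf_poisson of_nat_Suc)
    ultimately have "r * stein_sol r A i - real i * stein_sol r A (i - 1) =
        (measure ?P (A \<inter> {..i}) - measure ?P A * measure ?P {..i}) / pmf (poisson_pmf r) i -
        (measure ?P (A \<inter> {..j}) - measure ?P A * measure ?P {..j}) / pmf (poisson_pmf r) i"
      by (simp only:)
    also have "\<dots> = (indicator A i - measure ?P A) * pmf (poisson_pmf r) i / pmf (poisson_pmf r) i"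
      unfolding A U diff_divide_distrib [symmetric] by (simp add: algebra_simps del: pmf_poisson)
    finally show ?thesis using pos[of i] by (simp del: pmf_poisson)
  qed
qed

text \<open>Split \<open>A\<close> into its parts below, at and above \<open>i = Suc j\<close>. In
  the increment the parts below and above have nonpositive coefficients by the two tail bounds; only
  the point \<open>i\<close> itself can push upwards, by at most \<open>1 / i\<close>.\<close>

lemma stein_sol_increment_le:
  assumes r: "0 < r"
  shows "stein_sol r A (Suc j) - stein_sol r A j \<le> 1"
proof -
  let ?P = "measure_pmf (poisson_pmf r)"
  define i where "i = Suc j"
  define p where "p = pmf (poisson_pmf r) i"
  define a where "a = measure ?P (A \<inter> {..j})"
  define d where "d = measure ?P (A \<inter> {i})"
  define t where "t = measure ?P (A \<inter> {i<..})"
  define u where "u = measure ?P {..j}"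
  define v where "v = measure ?P {i<..}"
  have p: "0 < p" using r by (simp add: p_def)
  have i: "1 \<le> real i" by (simp add: i_def)
  have nn: "0 \<le> a" "0 \<le> d" "0 \<le> t" "0 \<le> u" "0 \<le> v"
    by (simp_all add: a_def d_def t_def u_def v_def)
  have single: "measure ?P {i} = p" by (simp add: p_def measure_pmf_single del: pmf_poisson)
  have dp: "d \<le> p"
    unfolding d_def single [symmetric] by (intro measure_pmf.finite_measure_mono) auto
  have split: "measure ?P (B \<union> C) = measure ?P B + measure ?P C" if "B \<inter> C = {}" for B C
    using that by (intro measure_pmf.finite_measure_Union) auto
  have Ui: "measure ?P {..i} = u + p"
    using split[of "{..j}" "{i}"] single by (auto simp: i_def u_def atMost_Suc)
  have AUi: "measure ?P (A \<inter> {..i}) = a + d"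
  proof -
    have "A \<inter> {..i} = (A \<inter> {..j}) \<union> (A \<inter> {i})" "(A \<inter> {..j}) \<inter> (A \<inter> {i}) = {}"
      by (auto simp: i_def)
    then show ?thesis using split[of "A \<inter> {..j}" "A \<inter> {i}"] by (simp only: a_def d_def)
  qed
  have Vi: "measure ?P {i..} = p + v"
  proof -
    have "{i..} = {i} \<union> {i<..}" by auto
    then show ?thesis using split[of "{i}" "{i<..}"] single by (simp add: v_def)
  qed
  have A: "measure ?P A = a + d + t"
  proof -
    have "A = (A \<inter> {..i}) \<union> (A \<inter> {i<..})" "(A \<inter> {..i}) \<inter> (A \<inter> {i<..}) = {}" by auto
    then have "measure ?P A = measure ?P (A \<inter> {..i}) + measure ?P (A \<inter> {i<..})"
      using split[of "A \<inter> {..i}" "A \<inter> {i<..}"] by (simp only:)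
    then show ?thesis using AUi by (simp add: t_def)
  qed
  have one: "u + p + v = 1"
  proof -
    have "(UNIV :: nat set) = {..i} \<union> {i<..}" "{..i} \<inter> {i<..} = {}" by auto
    then have "measure ?P UNIV = measure ?P {..i} + measure ?P {i<..}"
      using split[of "{..i}" "{i<..}"] by (simp only:)
    then show ?thesis using Ui by (simp add: v_def)
  qed
  have upper: "v / r \<le> (p + v) / real i"
    using poisson_upper_tail [OF r, of i] r i by (simp add: Vi field_simps flip: v_def)
  have "{..<i} = {..j}" by (auto simp: i_def)
  then have lower: "u / real i \<le> (u + p) / r"
    using poisson_lower_tail [OF r, of i] r i by (simp add: Ui field_simps flip: u_def)
  have pj: "r * pmf (poisson_pmf r) j = real i * p"
    using poisson_pmf_Suc [OF r, of j] by (simp add: i_def p_def del: pmf_poisson)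
  \<comment> \<open>The worst case is \<open>d = p\<close>, that is, \<open>i\<close> in
    \<open>A\<close>. The upper tail bound puts \<open>v\<close> over the denominator
    \<open>i\<close> as well, and then the three masses add up to 1.\<close>
  have "d * (v / r + u / real i) \<le> p * (v / r + u / real i)"
    using dp nn r by (intro mult_right_mono) auto
  also have "\<dots> \<le> p * ((p + v) / real i + u / real i)"
    using upper p by (intro mult_left_mono) auto
  also have "\<dots> = p * (1 / real i)"
    using one by (simp add: add_divide_distrib [symmetric] add.commute add.left_commute)
  also have "\<dots> \<le> p" using p i by (simp add: field_simps)
  finally have diag: "d * (v / r + u / real i) \<le> p" .
  have "stein_sol r A (Suc j) = ((a + d) - (a + d + t) * (u + p)) / (r * p)"
    unfolding stein_sol_def i_def [symmetric] AUi Ui A by (simp add: p_def)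
  \<comment> \<open>Multiplying \<open>a + d\<close> by the total mass \<open>u + p + v = 1\<close>
    makes the numerator bilinear, so that the terms common to both products cancel.\<close>
  also have "(a + d) - (a + d + t) * (u + p) = (a + d) * (u + p + v) - (a + d + t) * (u + p)"
    by (simp add: one)
  also have "\<dots> = (a + d) * v - t * (u + p)" by (simp add: algebra_simps)
  finally have s1: "stein_sol r A (Suc j) = ((a + d) * v - t * (u + p)) / (r * p)" .
  have "stein_sol r A j = (a - (a + d + t) * u) / (real i * p)"
    unfolding stein_sol_def A pj by (simp add: a_def u_def)
  also have "a - (a + d + t) * u = a * (u + p + v) - (a + d + t) * u" by (simp add: one)
  also have "\<dots> = a * (p + v) - (d + t) * u" by (simp add: algebra_simps)
  finally have s2: "stein_sol r A j = (a * (p + v) - (d + t) * u) / (real i * p)" .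
  have "p * (stein_sol r A (Suc j) - stein_sol r A j)
      = a * (v / r - (p + v) / real i) + t * (u / real i - (u + p) / r) + d * (v / r + u / real i)"
    unfolding s1 s2 using p r i by (simp add: field_simps)
  also have "\<dots> \<le> 0 + 0 + p"
    using upper lower nn diag by (intro add_mono mult_nonneg_nonpos) auto
  finally show ?thesis using p by simp
qed

text \<open>The numerator is the covariance of the events \<open>A\<close> and \<open>{..i}\<close>
  under the Poisson law, which changes sign when \<open>A\<close> is complemented. The one-sided
  increment bound, valid for all sets, thus becomes two-sided.\<close>

lemma stein_sol_Compl: "stein_sol r (- A) i = - stein_sol r A i"
proof -
  let ?P = "measure_pmf (poisson_pmf r)"
  have U: "measure ?P {..i} = measure ?P (A \<inter> {..i}) + measure ?P (- A \<inter> {..i})"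
    by (subst measure_pmf.finite_measure_Union [symmetric]) (auto intro!: arg_cong [where f = "measure ?P"])
  have A: "measure ?P (- A) = 1 - measure ?P A"
    using measure_pmf.prob_compl [of A "poisson_pmf r"] by (simp add: Compl_eq_Diff_UNIV)
  have "measure ?P (- A \<inter> {..i}) - measure ?P (- A) * measure ?P {..i} =
      - (measure ?P (A \<inter> {..i}) - measure ?P A * measure ?P {..i})"
    unfolding U A by (simp add: algebra_simps)
  then show ?thesis
    unfolding stein_sol_def by (simp only: minus_divide_left)
qed

lemma stein_sol_lipschitz:
  assumes r: "0 < r"
  shows "\<bar>stein_sol r A (i + m) - stein_sol r A i\<bar> \<le> real m"
proof (induction m)
  case (Suc m)
  have "\<bar>stein_sol r A (Suc (i + m)) - stein_sol r A (i + m)\<bar> \<le> 1"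
    using stein_sol_increment_le [OF r, of A "i + m"] stein_sol_increment_le [OF r, of "- A" "i + m"]
    by (simp add: stein_sol_Compl abs_le_iff)
  then show ?case using Suc by simp
qed simp

section \<open>Poisson approximation under local dependence\<close>

definition num_events :: "('i \<Rightarrow> 'a set) \<Rightarrow> 'i set \<Rightarrow> 'a \<Rightarrow> nat" where
  "num_events E J x = card {i \<in> J. x \<in> E i}"

lemma num_events_Un:
  assumes "finite J" "finite K" "J \<inter> K = {}"
  shows "num_events E (J \<union> K) x = num_events E J x + num_events E K x"
proof -
  have "{i \<in> J \<union> K. x \<in> E i} = {i \<in> J. x \<in> E i} \<union> {i \<in> K. x \<in> E i}" by auto
  then show ?thesis
    using assms unfolding num_events_def by (auto intro!: card_Un_disjoint)
qed

lemma real_num_events: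
  assumes "finite J"
  shows "real (num_events E J x) = (\<Sum>i\<in>J. indicator (E i) x)"
  using assms by (simp add: num_events_def indicator_def sum.If_cases Int_def)

text \<open>The Chen-Stein bound with neighbourhoods \<open>N i\<close>. Independence is asked only
  between \<open>E i\<close> and functions of the number of events outside \<open>N i\<close>; it is
  applied to the Stein solution itself. The Lipschitz constant 1 is the factor in front of both
  sums.\<close>

theorem poisson_approx_local_dependence:
  fixes p :: "'a pmf" and E :: "'i \<Rightarrow> 'a set" and I :: "'i set" and N :: "'i \<Rightarrow> 'i set"
  defines "r \<equiv> \<Sum>i\<in>I. measure p (E i)"
  assumes fin: "finite I" "finite (set_pmf p)"
    and N: "\<And>i. i \<in> I \<Longrightarrow> i \<in> N i \<and> N i \<subseteq> I"
    and indep: "\<And>i h. i \<in> I \<Longrightarrow>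
      measure_pmf.expectation p (\<lambda>x. indicator (E i) x * (h (num_events E (I - N i) x) :: real)) =
      measure p (E i) * measure_pmf.expectation p (\<lambda>x. h (num_events E (I - N i) x))"
    and r: "0 < r"
  shows "\<bar>measure (map_pmf (num_events E I) p) A - measure (poisson_pmf r) A\<bar> \<le>
    (\<Sum>i\<in>I. \<Sum>j\<in>N i - {i}. measure p (E i \<inter> E j)) +
    (\<Sum>i\<in>I. \<Sum>j\<in>N i. measure p (E i) * measure p (E j))"
proof -
  define g where "g = stein_sol r A"
  let ?EX = "measure_pmf.expectation p"
  let ?W = "num_events E I"
  let ?V = "\<lambda>i. num_events E (I - N i)"
  have int [simp]: "integrable (measure_pmf p) f" for f :: "'a \<Rightarrow> real"
    by (rule integrable_measure_pmf_finite [OF fin(2)])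
  have lip: "\<bar>g b - g a\<bar> \<le> real b - real a" if "a \<le> b" for a b
    using stein_sol_lipschitz [OF r, of A a "b - a"] that by (simp add: g_def of_nat_diff)
  \<comment> \<open>The Stein equation at \<open>?W x\<close>, with both the rate and the count
    split over the events.\<close>
  define D where "D i x = measure p (E i) * g (?W x) - indicator (E i) x * g (?W x - 1)" for i x
  define B where "B i x = measure p (E i) * (\<Sum>j\<in>N i. indicator (E j) x) +
    (\<Sum>j\<in>N i - {i}. indicator (E i) x * indicator (E j) x)" for i and x :: 'a
  \<comment> \<open>Subtracting \<open>g (?V i x)\<close> in both terms of \<open>D i\<close> leaves
    the expectation unchanged, by independence. The arguments of \<open>g\<close> then differ only
    by events in \<open>N i\<close>, so the Lipschitz bound yields \<open>B i\<close>.\<close>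
  define D' where "D' i x = measure p (E i) * (g (?W x) - g (?V i x)) -
    indicator (E i) x * (g (?W x - 1) - g (?V i x))" for i x
  have D'_B: "\<bar>D' i x\<bar> \<le> B i x" if i: "i \<in> I" for i x
  proof -
    have finN: "finite (N i)" using N[OF i] fin(1) finite_subset by blast
    have "?W x = ?V i x + num_events E (N i) x"
      using num_events_Un[of "I - N i" "N i" E x] fin(1) finN N[OF i]
      by (simp add: Un_absorb2 Int_commute)
    then have WV: "real (?W x) = real (?V i x) + (\<Sum>j\<in>N i. indicator (E j) x)"
      by (simp add: real_num_events finN)
    have nn: "0 \<le> (\<Sum>j\<in>N i. indicator (E j) x :: real)" "0 \<le> (\<Sum>j\<in>N i - {i}. indicator (E j) x :: real)"
      by (simp_all add: sum_nonneg)
    have "\<bar>measure p (E i) * (g (?W x) - g (?V i x))\<bar> \<le> measure p (E i) * (\<Sum>j\<in>N i. indicator (E j) x)"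
      using lip[of "?V i x" "?W x"] WV nn by (simp add: abs_mult mult_left_mono)
    moreover have "\<bar>indicator (E i) x * (g (?W x - 1) - g (?V i x))\<bar> \<le>
        (\<Sum>j\<in>N i - {i}. indicator (E i) x * indicator (E j) x)"
    proof (cases "x \<in> E i")
      case True
      \<comment> \<open>When \<open>E i\<close> occurs it adds 1 to the count in its own
        neighbourhood. This absorbs the shift in \<open>?W x - 1\<close>, keeps the truncated
        subtraction exact, and is why the remaining sum omits \<open>j = i\<close>.\<close>
      have "(\<Sum>j\<in>N i. indicator (E j) x :: real) = 1 + (\<Sum>j\<in>N i - {i}. indicator (E j) x)"
        using N[OF i] finN True by (subst sum.remove [of _ i]) simp_all
      then have "real (?W x) = real (?V i x) + 1 + (\<Sum>j\<in>N i - {i}. indicator (E j) x)"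
        using WV by simp
      then show ?thesis
        using lip[of "?V i x" "?W x - 1"] nn True by (simp add: of_nat_diff)
    qed simp
    ultimately show ?thesis
      unfolding D'_def B_def by linarith
  qed
  have ED: "?EX (D i) = ?EX (D' i)" if i: "i \<in> I" for i
  proof -
    have "D i = (\<lambda>x. D' i x + (measure p (E i) * g (?V i x) - indicator (E i) x * g (?V i x)))"
      by (simp add: fun_eq_iff D_def D'_def algebra_simps)
    then have "?EX (D i) = ?EX (D' i) + (measure p (E i) * ?EX (\<lambda>x. g (?V i x)) -
        ?EX (\<lambda>x. indicator (E i) x * g (?V i x)))"
      by simp
    then show ?thesis using indep[OF i, of g] by simp
  qed
  have pointwise: "indicator A (?W x) - measure (poisson_pmf r) A = (\<Sum>i\<in>I. D i x)" for x
    using stein_equation [OF r, of A "?W x"]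
    by (simp add: g_def D_def sum_subtractf r_def sum_distrib_right real_num_events fin(1))
  have "measure (map_pmf ?W p) A - measure (poisson_pmf r) A =
      ?EX (\<lambda>x. indicator A (?W x) - measure (poisson_pmf r) A)"
  proof -
    have "measure (map_pmf ?W p) A = ?EX (indicator (?W -` A))" by simp
    also have "indicator (?W -` A) = (\<lambda>x. indicator A (?W x) :: real)"
      by (auto simp: indicator_def fun_eq_iff)
    finally show ?thesis by simp
  qed
  also have "\<dots> = (\<Sum>i\<in>I. ?EX (D' i))"
    by (simp add: pointwise ED)
  finally have "\<bar>measure (map_pmf ?W p) A - measure (poisson_pmf r) A\<bar> \<le> (\<Sum>i\<in>I. \<bar>?EX (D' i)\<bar>)"
    by (simp only: sum_abs)
  also have "\<dots> \<le> (\<Sum>i\<in>I. ?EX (B i))"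
  proof (rule sum_mono)
    fix i assume "i \<in> I"
    have "\<bar>?EX (D' i)\<bar> \<le> ?EX (\<lambda>x. \<bar>D' i x\<bar>)" by (rule integral_abs_bound)
    also have "\<dots> \<le> ?EX (B i)" by (rule integral_mono) (simp_all add: D'_B[OF \<open>i \<in> I\<close>])
    finally show "\<bar>?EX (D' i)\<bar> \<le> ?EX (B i)" .
  qed
  also have "\<dots> = (\<Sum>i\<in>I. (\<Sum>j\<in>N i - {i}. measure p (E i \<inter> E j)) +
    (\<Sum>j\<in>N i. measure p (E i) * measure p (E j)))"
    unfolding B_def indicator_inter_arith [symmetric] by (simp add: sum_distrib_left add.commute)
  finally show ?thesis by (simp add: sum.distrib)
qed

section \<open>Triples of balls\<close>

lemma expectation_pair_pmf_mult:
  fixes g :: "'a \<Rightarrow> real" and h :: "'b \<Rightarrow> real"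
  assumes "finite (set_pmf p)" "finite (set_pmf q)"
  shows "measure_pmf.expectation (pair_pmf p q) (\<lambda>(x, y). g x * h y) =
    measure_pmf.expectation p g * measure_pmf.expectation q h"
proof -
  have "measure_pmf.expectation (pair_pmf p q) (\<lambda>(x, y). g x * h y) =
      (\<Sum>(x, y)\<in>set_pmf p \<times> set_pmf q. (g x * pmf p x) * (h y * pmf q y))"
    using assms
    by (subst integral_measure_pmf_real [where A = "set_pmf p \<times> set_pmf q"])
       (auto simp: pmf_pair mult_ac intro!: sum.cong)
  also have "\<dots> = (\<Sum>x\<in>set_pmf p. g x * pmf p x) * (\<Sum>y\<in>set_pmf q. h y * pmf q y)"
    by (simp add: sum_product sum.cartesian_product)
  also have "\<dots> = measure_pmf.expectation p g * measure_pmf.expectation q h"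
    using assms by (simp add: integral_measure_pmf_real [where A = "set_pmf p"]
        integral_measure_pmf_real [where A = "set_pmf q"])
  finally show ?thesis .
qed

text \<open>A sample on \<open>S \<union> T\<close> is glued from independent samples on
  \<open>S\<close> and on \<open>T\<close>; \<open>g\<close> sees only the first and
  \<open>h\<close> only the second.\<close>

lemma expectation_Pi_pmf_mult:
  fixes g h :: "('i \<Rightarrow> 'a) \<Rightarrow> real"
  assumes fin: "finite S" "finite T" and disj: "S \<inter> T = {}"
    and supp: "\<And>i. finite (set_pmf (p i))"
    and g: "\<forall>b b'. (\<forall>i\<in>S. b i = b' i) \<longrightarrow> g b = g b'"
    and h: "\<forall>b b'. (\<forall>i\<in>T. b i = b' i) \<longrightarrow> h b = h b'"
  shows "measure_pmf.expectation (Pi_pmf (S \<union> T) d p) (\<lambda>b. g b * h b) =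
    measure_pmf.expectation (Pi_pmf (S \<union> T) d p) g * measure_pmf.expectation (Pi_pmf (S \<union> T) d p) h"
proof -
  let ?EX = "measure_pmf.expectation (Pi_pmf (S \<union> T) d p)"
  have finite_supp: "finite (set_pmf (Pi_pmf J d p))" if "finite J" for J
    using that supp by (auto simp: set_Pi_pmf)
  have mult: "?EX (\<lambda>b. g' b * h' b) =
      measure_pmf.expectation (Pi_pmf S d p) g' * measure_pmf.expectation (Pi_pmf T d p) h'"
    if g': "\<forall>b b'. (\<forall>i\<in>S. b i = b' i) \<longrightarrow> g' b = g' b'"
      and h': "\<forall>b b'. (\<forall>i\<in>T. b i = b' i) \<longrightarrow> h' b = h' b'"
    for g' h' :: "('i \<Rightarrow> 'a) \<Rightarrow> real"
  proof -
    have "g' (\<lambda>i. if i \<in> S then b i else c i) = g' b" for b c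
      by (rule g' [rule_format]) simp
    moreover have "h' (\<lambda>i. if i \<in> S then b i else c i) = h' c" for b c
      using disj by (intro h' [rule_format]) auto
    ultimately show ?thesis
      unfolding Pi_pmf_union [OF fin disj]
      by (simp add: case_prod_unfold
          expectation_pair_pmf_mult [OF finite_supp finite_supp, OF fin, unfolded case_prod_unfold])
  qed
  \<comment> \<open>Pairing with the constant 1 identifies each expectation over the whole product
    with one over its own coordinates.\<close>
  have "?EX g = measure_pmf.expectation (Pi_pmf S d p) g"
    using mult[OF g, of "\<lambda>_. 1"] by simp
  moreover have "?EX h = measure_pmf.expectation (Pi_pmf T d p) h"
    using mult[OF _ h, of "\<lambda>_. 1"] by simp
  ultimately show ?thesis
    using mult[OF g h] by simp
qed

section \<open>Sets of balls sharing a box\<close>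

definition same_box :: "nat set \<Rightarrow> (nat \<Rightarrow> nat) set" where
  "same_box S = {b. \<exists>c. \<forall>i\<in>S. b i = c}"

lemma same_box_cong: "(\<And>i. i \<in> S \<Longrightarrow> b i = b' i) \<Longrightarrow> b \<in> same_box S \<longleftrightarrow> b' \<in> same_box S"
  by (simp add: same_box_def)

text \<open>A shared ball determines the common box of both sets. The joint event of two overlapping
  triples is therefore again of the form \<open>same_box\<close>, so \<open>prob_same_box\<close>
  covers it.\<close>

lemma same_box_Un:
  assumes "S \<inter> R \<noteq> {}"
  shows "same_box S \<inter> same_box R = same_box (S \<union> R)"
proof -
  obtain s where "s \<in> S" "s \<in> R" using assms by blast
  then have "b \<in> same_box S \<inter> same_box R \<longleftrightarrow> (\<forall>i\<in>S \<union> R. b i = b s)"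
    "b \<in> same_box (S \<union> R) \<longleftrightarrow> (\<forall>i\<in>S \<union> R. b i = b s)" for b
    unfolding same_box_def by auto
  then show ?thesis by blast
qed

lemma finite_set_ball_drop: "0 < n \<Longrightarrow> finite (set_pmf (ball_drop k n))"
  by (auto simp: ball_drop_def set_Pi_pmf)

text \<open>Sum over the \<open>n\<close> possible common boxes: the events \<open>F c\<close> are
  disjoint, and each is a product event of probability \<open>(1 / n) ^ card S\<close>.\<close>

lemma prob_same_box:
  assumes n: "0 < n" and S: "S \<subseteq> {1..k}" "S \<noteq> {}"
  shows "measure (ball_drop k n) (same_box S) = 1 / real n ^ (card S - 1)"
proof -
  let ?P = "measure_pmf (ball_drop k n)"
  define F where "F c = {b::nat \<Rightarrow> nat. \<forall>i\<in>S. b i = c}" for c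
  obtain s where s: "s \<in> S" using S by auto
  have range: "b i \<in> {1..n}" if "b \<in> set_pmf (ball_drop k n)" "i \<in> S" for b i
    using that S n by (auto simp: ball_drop_def set_Pi_pmf PiE_dflt_def)
  have prob_F: "measure ?P (F c) = (1 / real n) ^ card S" if "c \<in> {1..n}" for c
  proof -
    have "F c = Pi {1..k} (\<lambda>i. if i \<in> S then {c} else UNIV)"
      using S by (auto simp: F_def Pi_def)
    then have "measure ?P (F c) =
        (\<Prod>i\<in>{1..k}. measure (pmf_of_set {1..n}) (if i \<in> S then {c} else UNIV))"
      by (simp add: ball_drop_def measure_Pi_pmf_Pi)
    also have "\<dots> = (\<Prod>i\<in>{1..k}. if i \<in> S then 1 / real n else 1)"
      using n that by (intro prod.cong) (auto simp: measure_pmf_single)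
    also have "\<dots> = (1 / real n) ^ card S"
      using S by (simp add: prod.If_cases Int_absorb1)
    finally show ?thesis .
  qed
  \<comment> \<open>This holds only on the support: \<open>same_box\<close> admits any common value,
    while samples take values in \<open>{1..n}\<close> on \<open>S\<close>.\<close>
  have "b \<in> same_box S \<longleftrightarrow> b \<in> (\<Union>c\<in>{1..n}. F c)" if "b \<in> set_pmf (ball_drop k n)" for b
    using range[OF that s] s by (auto simp: same_box_def F_def intro!: bexI [of _ "b s"])
  then have "measure ?P (same_box S) = measure ?P (\<Union>c\<in>{1..n}. F c)"
    by (intro measure_eq_AE) (auto simp: AE_measure_pmf_iff simp del: UN_iff)
  also have "\<dots> = (\<Sum>c\<in>{1..n}. measure ?P (F c))"
    using s by (intro measure_pmf.finite_measure_finite_Union) (auto simp: disjoint_family_on_def F_def)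
  also have "\<dots> = real n * (1 / real n) ^ card S" by (simp add: prob_F)
  also have "card S = Suc (card S - 1)"
    using S finite_subset[OF S(1)] by (simp add: card_gt_0_iff)
  also have "real n * (1 / real n) ^ Suc (card S - 1) = 1 / real n ^ (card S - 1)"
    using n by (simp add: power_one_over divide_simps)
  finally show ?thesis .
qed

text \<open>Unordered triples, so that overlaps are expressed by unions and intersections.\<close>

definition triple_sets :: "nat \<Rightarrow> nat set set" where
  "triple_sets k = {S. S \<subseteq> {1..k} \<and> card S = 3}"

lemma finite_triple_sets: "finite (triple_sets k)"
  unfolding triple_sets_def by (rule finite_subset [of _ "Pow {1..k}"]) auto

lemma card_triple_sets: "card (triple_sets k) = k choose 3"
  unfolding triple_sets_def by (subst n_subsets) auto

lemma triple_setsD: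
  assumes "S \<in> triple_sets k"
  shows "finite S" "S \<subseteq> {1..k}" "card S = 3" "S \<noteq> {}"
  using assms finite_subset[of S "{1..k}"] by (auto simp: triple_sets_def)

text \<open>Increasing index triples correspond to three-element sets, the inverse map being the
  sorted list of the set.\<close>

lemma triples_eq_num_events: "triples k = num_events same_box (triple_sets k)"
proof
  fix b :: "nat \<Rightarrow> nat"
  let ?O = "{(i, j, l). 1 \<le> i \<and> i < j \<and> j < l \<and> l \<le> k \<and> b i = b j \<and> b j = b l}"
  have "bij_betw (\<lambda>(i, j, l). {i, j, l}) ?O {S \<in> triple_sets k. b \<in> same_box S}"
  proof (rule bij_betw_imageI)
    show "inj_on (\<lambda>(i, j, l). {i, j, l}) ?O"
    proof (rule inj_onI, clarsimp)
      fix i j l i' j' l' :: nat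
      assume "i < j" "j < l" "i' < j'" "j' < l'" "{i, j, l} = {i', j', l'}"
      then show "i = i' \<and> j = j' \<and> l = l'"
        using sorted_distinct_set_unique[of "[i, j, l]" "[i', j', l']"] by simp
    qed
    show "(\<lambda>(i, j, l). {i, j, l}) ` ?O = {S \<in> triple_sets k. b \<in> same_box S}"
    proof (intro equalityI subsetI)
      fix S assume "S \<in> (\<lambda>(i, j, l). {i, j, l}) ` ?O"
      then show "S \<in> {S \<in> triple_sets k. b \<in> same_box S}"
        by (auto simp: triple_sets_def same_box_def)
    next
      fix S assume S: "S \<in> {S \<in> triple_sets k. b \<in> same_box S}"
      then have "length (sorted_list_of_set S) = 3" by (simp add: triple_sets_def)
      then obtain i j l where ijl: "sorted_list_of_set S = [i, j, l]"
        unfolding numeral_3_eq_3 length_Suc_conv length_0_conv by blast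
      have "finite S" using S triple_setsD by blast
      then have set: "S = {i, j, l}"
        using set_sorted_list_of_set[of S] ijl by simp
      have "i < j" "j < l"
        using strict_sorted_list_of_set[of S] ijl by simp_all
      then have "(i, j, l) \<in> ?O"
        using S set by (auto simp: triple_sets_def same_box_def)
      then show "S \<in> (\<lambda>(i, j, l). {i, j, l}) ` ?O"
        using set by (intro image_eqI [of _ _ "(i, j, l)"]) auto
    qed
  qed
  then show "triples k b = num_events same_box (triple_sets k) b"
    unfolding triples_def num_events_def by (rule bij_betw_same_card)
qed

text \<open>Choose the union first, then two subsets of it, in at most \<open>2 ^ m * 2 ^ m\<close>
  ways. The sizes of \<open>S\<close> and \<open>R\<close> are left free because only the power of
  \<open>k\<close> matters.\<close>

lemma card_pairs_with_union:
  "card {(S, R). S \<union> R \<subseteq> {1..k} \<and> card (S \<union> R) = m} \<le> k ^ m * 4 ^ m" (is "card ?Q \<le> _")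
proof -
  let ?U = "{U. U \<subseteq> {1..k} \<and> card U = m}"
  have finU: "finite ?U" by (rule finite_subset [of _ "Pow {1..k}"]) auto
  have sub: "?Q \<subseteq> (\<Union>U\<in>?U. Pow U \<times> Pow U)"
  proof
    fix z assume "z \<in> ?Q"
    then show "z \<in> (\<Union>U\<in>?U. Pow U \<times> Pow U)"
      by (intro UN_I [of "fst z \<union> snd z"]) auto
  qed
  have "card (Pow U \<times> Pow U) = 4 ^ m" if "U \<in> ?U" for U
  proof -
    have "finite U" using that finite_subset by blast
    then show ?thesis using that by (simp add: card_cartesian_product card_Pow flip: power_mult_distrib)
  qed
  then have "(\<Sum>U\<in>?U. card (Pow U \<times> Pow U)) = (k choose m) * 4 ^ m"
    by (simp add: n_subsets)
  moreover have "card ?Q \<le> (\<Sum>U\<in>?U. card (Pow U \<times> Pow U))"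
  proof -
    have "finite U" if "U \<in> ?U" for U using that finite_subset by blast
    then have "card ?Q \<le> card (\<Union>U\<in>?U. Pow U \<times> Pow U)"
      using finU by (intro card_mono sub) auto
    also have "\<dots> \<le> (\<Sum>U\<in>?U. card (Pow U \<times> Pow U))" by (rule card_UN_le [OF finU])
    finally show ?thesis .
  qed
  moreover have "k choose m \<le> k ^ m"
    by (cases "m \<le> k") (simp_all add: binomial_le_pow binomial_eq_0)
  ultimately show ?thesis using mult_le_mono1[of "k choose m" "k ^ m" "4 ^ m"] by linarith
qed

section \<open>The total variation bound\<close>

lemma tv_dist_pmf_le:
  fixes p q :: "'a pmf"
  assumes "\<And>A. \<bar>measure p A - measure q A\<bar> \<le> c"
  shows "tv_dist (measure_pmf p) (measure_pmf q) \<le> c"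
  unfolding tv_dist_def by (rule cSUP_least) (use assms in auto)

lemma measure_pmf_diff_le_one: "\<bar>measure (measure_pmf p) A - measure (measure_pmf q) A\<bar> \<le> 1"
  using measure_pmf.prob_le_1[of p A] measure_pmf.prob_le_1[of q A]
    measure_nonneg[of "measure_pmf p" A] measure_nonneg[of "measure_pmf q" A]
  by linarith

text \<open>A real supremum is an upper bound only of a bounded family; here the bound is 1.\<close>

lemma le_tv_dist_pmf:
  fixes p q :: "'a pmf"
  shows "\<bar>measure p A - measure q A\<bar> \<le> tv_dist (measure_pmf p) (measure_pmf q)"
  unfolding tv_dist_def
  by (rule cSUP_upper) (auto intro!: bdd_aboveI [of _ 1] measure_pmf_diff_le_one)

text \<open>The constant collects \<open>4 ^ 4\<close> from the pairs sharing two balls and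
  \<open>4 ^ 5 + (4 ^ 3 + 4 ^ 4 + 4 ^ 5)\<close> from the terms of order
  \<open>k ^ 5 / n ^ 4\<close>.\<close>

lemma tv_dist_triples_bound_le:
  assumes n: "0 < n" and kn: "k \<le> n"
  shows "tv_dist (measure_pmf (triples_law k n)) (measure_pmf (Poi (real (k choose 3) * (1 / real n ^ 2))))
    \<le> 2624 * (real k ^ 4 / real n ^ 3)"
proof (cases "k choose 3 = 0")
  \<comment> \<open>With fewer than three balls the rate is 0, outside the range of the Stein
    equation, but both laws are the point mass at 0.\<close>
  case True
  then have "triple_sets k = {}"
    by (metis card_0_eq card_triple_sets finite_triple_sets)
  then have "triples k = (\<lambda>_. 0)"
    by (simp add: triples_eq_num_events num_events_def fun_eq_iff)
  then have "triples_law k n = return_pmf 0"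
    by (simp add: triples_law_def map_pmf_const)
  then show ?thesis
    using True by (intro tv_dist_pmf_le) (simp add: Poi_def)
next
  case False
  define T where "T = triple_sets k"
  \<comment> \<open>A triple meets itself, hence belongs to its own neighbourhood, as the general
    bound demands.\<close>
  define N where "N S = {R \<in> T. R \<inter> S \<noteq> {}}" for S
  \<comment> \<open>For overlapping pairs the size of the union determines the joint probability.
    Not requiring the two sets to have size 3 costs only a constant factor.\<close>
  define Q where "Q m = {(S, R). S \<union> R \<subseteq> {1..k} \<and> card (S \<union> R) = m}" for m
  define r where "r = (\<Sum>S\<in>T. measure (ball_drop k n) (same_box S))"
  note TD = triple_setsD [of _ k, folded T_def]
  have finT: "finite T" by (simp add: T_def finite_triple_sets)
  have prob_T: "measure (ball_drop k n) (same_box S) = 1 / real n ^ 2" if "S \<in> T" for S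
    using prob_same_box[OF n TD(2)[OF that] TD(4)[OF that]] TD(3)[OF that]
    by (simp add: eval_nat_numeral)
  have r: "r = real (k choose 3) * (1 / real n ^ 2)"
    by (simp add: r_def prob_T card_triple_sets T_def)
  have r0: "0 < r" using False n by (simp add: r)
  have indep: "measure_pmf.expectation (ball_drop k n)
      (\<lambda>b. indicator (same_box S) b * (h (num_events same_box (T - N S) b) :: real)) =
      measure (ball_drop k n) (same_box S) *
      measure_pmf.expectation (ball_drop k n) (\<lambda>b. h (num_events same_box (T - N S) b))"
    if S: "S \<in> T" for S h
  proof -
    define g :: "(nat \<Rightarrow> nat) \<Rightarrow> real" where "g = indicator (same_box S)"
    define h' where "h' = (\<lambda>b. h (num_events same_box (T - N S) b))"
    have fin: "finite S" "finite ({1..k} - S)" "S \<inter> ({1..k} - S) = {}"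
      using TD(1)[OF S] by auto
    have supp: "finite (set_pmf (pmf_of_set {1..n}))"
      using n by (subst set_pmf_of_set) auto
    have dep_g: "\<forall>b b'. (\<forall>i\<in>S. b i = b' i) \<longrightarrow> g b = g b'"
    proof (intro allI impI)
      fix b b' :: "nat \<Rightarrow> nat" assume eq: "\<forall>i\<in>S. b i = b' i"
      have "b \<in> same_box S \<longleftrightarrow> b' \<in> same_box S" by (rule same_box_cong) (simp add: eq)
      then show "g b = g b'" by (simp add: g_def indicator_def)
    qed
    \<comment> \<open>A triple outside \<open>N S\<close> is disjoint from \<open>S\<close>, so the
      count depends only on the balls not in \<open>S\<close>.\<close>
    have dep_h: "\<forall>b b'. (\<forall>i\<in>{1..k} - S. b i = b' i) \<longrightarrow> h' b = h' b'"
    proof (intro allI impI)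
      fix b b' :: "nat \<Rightarrow> nat" assume eq: "\<forall>i\<in>{1..k} - S. b i = b' i"
      have "b \<in> same_box R \<longleftrightarrow> b' \<in> same_box R" if "R \<in> T - N S" for R
        using that TD(2)[of R] by (intro same_box_cong eq [rule_format]) (auto simp: N_def)
      then have "{R \<in> T - N S. b \<in> same_box R} = {R \<in> T - N S. b' \<in> same_box R}" by blast
      then show "h' b = h' b'" by (simp add: h'_def num_events_def)
    qed
    have "S \<union> ({1..k} - S) = {1..k}" using TD(2)[OF S] by blast
    then have "measure_pmf.expectation (ball_drop k n) (\<lambda>b. g b * h' b) =
        measure_pmf.expectation (ball_drop k n) g * measure_pmf.expectation (ball_drop k n) h'"
      using expectation_Pi_pmf_mult [OF fin supp dep_g dep_h] unfolding ball_drop_def by simp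
    moreover have "measure_pmf.expectation (ball_drop k n) g = measure (ball_drop k n) (same_box S)"
      unfolding g_def by simp
    ultimately show ?thesis by (simp only: g_def h'_def)
  qed
  have card_inter: "(S, R) \<in> Q 3 \<union> Q 4 \<union> Q 5" "S \<noteq> R \<Longrightarrow> (S, R) \<in> Q 4 \<union> Q 5"
    if "S \<in> T" "R \<in> N S" for S R
  proof -
    have R: "R \<in> T" "R \<inter> S \<noteq> {}" using that by (auto simp: N_def)
    note fin = TD(1)[OF that(1)] TD(1)[OF R(1)]
    have c: "card S = 3" "card R = 3" using TD(3) that R by auto
    have "card (S \<inter> R) \<noteq> 0" using R fin by auto
    then have le5: "card (S \<union> R) \<le> 5"
      using card_Un_Int[OF fin] c by linarith
    have ge3: "3 \<le> card (S \<union> R)"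
      using card_mono[of "S \<union> R" S] fin c by simp
    have sub: "S \<union> R \<subseteq> {1..k}" using TD(2) that R by blast
    show "(S, R) \<in> Q 3 \<union> Q 4 \<union> Q 5"
      using sub le5 ge3 by (auto simp: Q_def)
    assume "S \<noteq> R"
    have "card (S \<union> R) \<noteq> 3"
    proof
      assume c3: "card (S \<union> R) = 3"
      have "S = S \<union> R" by (rule card_subset_eq) (use fin c c3 in auto)
      moreover have "R = S \<union> R" by (rule card_subset_eq) (use fin c c3 in auto)
      ultimately show False using \<open>S \<noteq> R\<close> by simp
    qed
    then show "(S, R) \<in> Q 4 \<union> Q 5"
      using sub le5 ge3 by (auto simp: Q_def)
  qed
  have finQ: "finite (Q m)" for m
    by (rule finite_subset [of _ "Pow {1..k} \<times> Pow {1..k}"]) (auto simp: Q_def)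
  have finN: "finite (N S)" for S using finT by (simp add: N_def)
  have card_Q: "real (card (Q m)) \<le> real k ^ m * 4 ^ m" for m
  proof -
    have "real (card (Q m)) \<le> real (k ^ m * 4 ^ m)"
      unfolding Q_def of_nat_le_iff by (rule card_pairs_with_union)
    then show ?thesis by simp
  qed
  have "(\<Sum>S\<in>T. \<Sum>R\<in>N S - {S}. measure (ball_drop k n) (same_box S \<inter> same_box R))
      = (\<Sum>S\<in>T. \<Sum>R\<in>N S - {S}. 1 / real n ^ (card (S \<union> R) - 1))"
  proof (intro sum.cong refl)
    fix S R assume SR: "S \<in> T" "R \<in> N S - {S}"
    then have "S \<inter> R \<noteq> {}" "S \<union> R \<subseteq> {1..k}" using TD(2) by (auto simp: N_def)
    then show "measure (ball_drop k n) (same_box S \<inter> same_box R) = 1 / real n ^ (card (S \<union> R) - 1)"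
      using prob_same_box[OF n, of "S \<union> R" k] by (subst same_box_Un) auto
  qed
  also have "\<dots> = (\<Sum>(S, R)\<in>(SIGMA S:T. N S - {S}). 1 / real n ^ (card (S \<union> R) - 1))"
    by (rule sum.Sigma) (use finT finN in auto)
  also have "\<dots> \<le> (\<Sum>(S, R)\<in>Q 4 \<union> Q 5. 1 / real n ^ (card (S \<union> R) - 1))"
  proof (rule sum_mono2)
    show "(SIGMA S:T. N S - {S}) \<subseteq> Q 4 \<union> Q 5"
      using card_inter(2) by blast
  qed (use finQ in auto)
  also have "\<dots> = (\<Sum>(S, R)\<in>Q 4. 1 / real n ^ (card (S \<union> R) - 1)) +
      (\<Sum>(S, R)\<in>Q 5. 1 / real n ^ (card (S \<union> R) - 1))"
    by (rule sum.union_disjoint) (use finQ in \<open>auto simp: Q_def\<close>)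
  \<comment> \<open>Two shared balls leave a union of 4 and exponent 3; one shared ball leaves a
    union of 5 and exponent 4.\<close>
  also have "(\<Sum>(S, R)\<in>Q 4. 1 / real n ^ (card (S \<union> R) - 1)) = (\<Sum>(S, R)\<in>Q 4. 1 / real n ^ 3)"
    by (rule sum.cong) (auto simp: Q_def)
  also have "(\<Sum>(S, R)\<in>Q 5. 1 / real n ^ (card (S \<union> R) - 1)) = (\<Sum>(S, R)\<in>Q 5. 1 / real n ^ 4)"
    by (rule sum.cong) (auto simp: Q_def)
  finally have b2: "(\<Sum>S\<in>T. \<Sum>R\<in>N S - {S}. measure (ball_drop k n) (same_box S \<inter> same_box R))
      \<le> real (card (Q 4)) / real n ^ 3 + real (card (Q 5)) / real n ^ 4"
    by simp
  \<comment> \<open>Here every pair weighs \<open>1 / n ^ 4\<close> whatever its overlap, so the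
    pairs need only be counted.\<close>
  have "(\<Sum>S\<in>T. \<Sum>R\<in>N S. measure (ball_drop k n) (same_box S) * measure (ball_drop k n) (same_box R))
      = (\<Sum>S\<in>T. \<Sum>R\<in>N S. 1 / real n ^ 4)"
    by (intro sum.cong refl) (auto simp: prob_T N_def simp flip: power_add)
  also have "\<dots> = real (card (SIGMA S:T. N S)) / real n ^ 4"
    by (subst sum.Sigma) (use finT finN in auto)
  also have "card (SIGMA S:T. N S) \<le> card (Q 3 \<union> Q 4 \<union> Q 5)"
    by (rule card_mono) (use finQ card_inter(1) in blast)+
  also have "\<dots> \<le> card (Q 3) + card (Q 4) + card (Q 5)"
    by (meson card_Un_le add_le_mono1 le_trans)
  finally have b1: "(\<Sum>S\<in>T. \<Sum>R\<in>N S. measure (ball_drop k n) (same_box S) * measure (ball_drop k n) (same_box R))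
      \<le> (real (card (Q 3)) + real (card (Q 4)) + real (card (Q 5))) / real n ^ 4"
    by (simp add: divide_right_mono)
  define K where "K = real k"
  define x where "x = real n"
  have "k \<noteq> 0" using False by (cases k) auto
  then have K: "1 \<le> K" "K \<le> x" using kn by (simp_all add: K_def x_def)
  \<comment> \<open>Counts that are divided by \<open>x ^ 4\<close> are all raised to order
    \<open>K ^ 5\<close>, using \<open>1 \<le> K\<close>, so that \<open>K5\<close> handles them
    together.\<close>
  have Q3: "real (card (Q 3)) \<le> 64 * K ^ 5"
    using card_Q[of 3] power_increasing[of 3 5 K] K by (simp add: K_def)
  have Q4: "real (card (Q 4)) \<le> 256 * K ^ 4"
    using card_Q[of 4] by (simp add: K_def)
  have Q4': "real (card (Q 4)) \<le> 256 * K ^ 5"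
    using Q4 power_increasing[of 4 5 K] K by simp
  have Q5: "real (card (Q 5)) \<le> 1024 * K ^ 5"
    using card_Q[of 5] by (simp add: K_def)
  \<comment> \<open>This is where \<open>k \<le> n\<close> trades a factor \<open>K / x\<close> for
    1.\<close>
  have K5: "K ^ 5 / x ^ 4 \<le> K ^ 4 / x ^ 3"
    using K mult_left_mono[of K x "K ^ 4"] by (simp add: field_simps eval_nat_numeral)
  show ?thesis
  proof (rule tv_dist_pmf_le)
    fix A
    have "\<bar>measure (triples_law k n) A - measure (Poi (real (k choose 3) * (1 / real n ^ 2))) A\<bar>
        = \<bar>measure (map_pmf (num_events same_box T) (ball_drop k n)) A - measure (poisson_pmf r) A\<bar>"
      using r0 unfolding r [symmetric] by (simp add: triples_law_def triples_eq_num_events T_def Poi_def)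
    also have "\<dots> \<le> (\<Sum>S\<in>T. \<Sum>R\<in>N S - {S}. measure (ball_drop k n) (same_box S \<inter> same_box R)) +
        (\<Sum>S\<in>T. \<Sum>R\<in>N S. measure (ball_drop k n) (same_box S) * measure (ball_drop k n) (same_box R))"
      unfolding r_def
      by (rule poisson_approx_local_dependence)
        (use finT finite_set_ball_drop[OF n] TD indep r0 in \<open>auto simp: N_def r_def\<close>)
    also have "\<dots> \<le> (real (card (Q 4)) / x ^ 3 + real (card (Q 5)) / x ^ 4) +
        (real (card (Q 3)) + real (card (Q 4)) + real (card (Q 5))) / x ^ 4"
      unfolding x_def by (rule add_mono [OF b2 b1])
    also have "\<dots> \<le> (256 * K ^ 4 / x ^ 3 + 1024 * K ^ 5 / x ^ 4) + (64 * K ^ 5 + 256 * K ^ 5 + 1024 * K ^ 5) / x ^ 4"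
      using K Q3 Q4 Q4' Q5 by (intro add_mono divide_right_mono) auto
    also have "\<dots> = 256 * (K ^ 4 / x ^ 3) + 2368 * (K ^ 5 / x ^ 4)"
      by (simp add: add_divide_distrib)
    also have "\<dots> \<le> 2624 * (K ^ 4 / x ^ 3)"
      using K5 by simp
    finally show "\<bar>measure (triples_law k n) A - measure (Poi (real (k choose 3) * (1 / real n ^ 2))) A\<bar>
        \<le> 2624 * (real k ^ 4 / real n ^ 3)" by (simp add: K_def x_def)
  qed
qed

lemma tv_dist_triples_bound:
  assumes n: "0 < n"
  shows "tv_dist (measure_pmf (triples_law k n)) (measure_pmf (Poi (real (k choose 3) * (1 / real n ^ 2))))
    \<le> 2624 * (real k ^ 4 / real n ^ 3)"
proof (cases "k \<le> n")
  case True
  then show ?thesis by (rule tv_dist_triples_bound_le [OF n])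
next
  case False
  have "real n ^ 3 * 1 \<le> real k ^ 3 * real k"
    using False n by (intro mult_mono power_mono) auto
  then have "1 \<le> real k ^ 4 / real n ^ 3"
    using n by (simp add: le_divide_eq eval_nat_numeral mult_ac)
  then have "1 \<le> 2624 * (real k ^ 4 / real n ^ 3)" by linarith
  then show ?thesis
    by (intro tv_dist_pmf_le order_trans [OF measure_pmf_diff_le_one])
qed

section \<open>The limiting regime\<close>

lemma cdf_real_law: "cdf (real_law p) x = measure p {m. real m \<le> x}"
proof -
  have "real -` {..x} = {m. real m \<le> x}" by auto
  then show ?thesis
    by (simp add: cdf_def real_law_def measure_distr)
qed

text \<open>At each real \<open>x\<close> the distribution function is the probability of a finite
  set of naturals, so it converges at every point and not just at continuity points.\<close>

lemma weak_conv_m_real_lawI: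
  fixes p :: "nat \<Rightarrow> nat pmf" and q :: "nat pmf"
  assumes "\<And>A. finite A \<Longrightarrow> (\<lambda>n. measure (p n) A) \<longlonglongrightarrow> measure q A"
  shows "weak_conv_m (\<lambda>n. real_law (p n)) (real_law q)"
proof -
  have "finite {m. real m \<le> x}" for x
    by (rule finite_subset [of _ "{..nat \<lfloor>x\<rfloor>}"]) (auto simp: le_nat_floor)
  then show ?thesis
    unfolding weak_conv_m_def weak_conv_def cdf_real_law by (blast intro: assms)
qed

text \<open>On a finite set the Poisson probability is a finite sum of continuous functions of the
  rate.\<close>

lemma tendsto_measure_Poi:
  assumes lim: "r \<longlonglongrightarrow> s" and s: "0 < s" and A: "finite A"
  shows "(\<lambda>n. measure (Poi (r n)) A) \<longlonglongrightarrow> measure (Poi s) A"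
proof -
  have meas: "measure (Poi t) A = (\<Sum>m\<in>A. t ^ m / fact m * exp (- t))" if "0 < t" for t
    using that A by (simp add: Poi_def measure_measure_pmf_finite)
  have "(\<lambda>n. \<Sum>m\<in>A. r n ^ m / fact m * exp (- r n)) \<longlonglongrightarrow> measure (Poi s) A"
    unfolding meas [OF s] by (intro tendsto_intros lim) auto
  \<comment> \<open>The formula is for positive rates. Early \<open>r n\<close> may fail to be
    positive, but \<open>0 < s\<close> makes them so eventually.\<close>
  moreover have "\<forall>\<^sub>F n in sequentially. (\<Sum>m\<in>A. r n ^ m / fact m * exp (- r n)) = measure (Poi (r n)) A"
    using order_tendstoD(1) [OF lim s] by eventually_elim (simp add: meas)
  ultimately show ?thesis by (rule Lim_transform_eventually)
qed

text \<open>The non-triviality of the limit: at a positive rate every natural number has positive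
  mass.\<close>

lemma Poi_neq_return_pmf:
  assumes "0 < r"
  shows "Poi r \<noteq> return_pmf m"
proof
  assume "Poi r = return_pmf m"
  then have "set_pmf (Poi r) = {m}" by simp
  then have "(UNIV :: nat set) = {m}" using assms by (simp add: Poi_def)
  then show False by (metis finite.emptyI finite_insert infinite_UNIV_nat)
qed

section \<open>Asymptotics of the mean and of the error term\<close>

lemma real_choose_3: "real (m choose 3) = real m * (real m - 1) * (real m - 2) / 6"
  by (simp add: binomial_gbinomial gbinomial_prod_rev numeral_3_eq_3 fact_numeral)

text \<open>Rounding down loses at most 1, which vanishes after division by \<open>s n\<close>. Once
  \<open>s n\<close> is positive, \<open>nat\<close> acts on a nonnegative integer and changes
  nothing.\<close>

lemma tendsto_floor_scaled:
  fixes s :: "nat \<Rightarrow> real"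
  assumes \<theta>: "0 < \<theta>" and s: "filterlim s at_top sequentially"
  shows "(\<lambda>n. real (nat \<lfloor>\<theta> * s n\<rfloor>) / s n) \<longlonglongrightarrow> \<theta>"
proof (rule tendsto_sandwich)
  have pos: "\<forall>\<^sub>F n in sequentially. 0 < s n"
    using s by (simp add: filterlim_at_top_dense)
  have floor: "real (nat \<lfloor>\<theta> * s n\<rfloor>) \<le> \<theta> * s n" "\<theta> * s n - 1 \<le> real (nat \<lfloor>\<theta> * s n\<rfloor>)"
    if "0 < s n" for n
  proof -
    have "0 \<le> \<lfloor>\<theta> * s n\<rfloor>" using \<theta> that by simp
    then have "real (nat \<lfloor>\<theta> * s n\<rfloor>) = of_int \<lfloor>\<theta> * s n\<rfloor>" by simp
    then show "real (nat \<lfloor>\<theta> * s n\<rfloor>) \<le> \<theta> * s n" "\<theta> * s n - 1 \<le> real (nat \<lfloor>\<theta> * s n\<rfloor>)" by linarith+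
  qed
  show "\<forall>\<^sub>F n in sequentially. real (nat \<lfloor>\<theta> * s n\<rfloor>) / s n \<le> \<theta>"
    using pos by eventually_elim (simp add: floor divide_le_eq)
  show "\<forall>\<^sub>F n in sequentially. \<theta> - 1 / s n \<le> real (nat \<lfloor>\<theta> * s n\<rfloor>) / s n"
    using pos
  proof eventually_elim
    case (elim n)
    then have "\<theta> - 1 / s n = (\<theta> * s n - 1) / s n" by (simp add: field_simps)
    also have "\<dots> \<le> real (nat \<lfloor>\<theta> * s n\<rfloor>) / s n"
      using elim floor(2) by (intro divide_right_mono) auto
    finally show ?case .
  qed
  have "(\<lambda>n. \<theta> - 1 / s n) \<longlonglongrightarrow> \<theta> - 0"
    by (intro tendsto_diff tendsto_const tendsto_divide_0 [OF tendsto_const]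
        filterlim_at_top_imp_at_infinity s)
  then show "(\<lambda>n. \<theta> - 1 / s n) \<longlonglongrightarrow> \<theta>" by simp
qed (rule tendsto_const)

context
  fixes \<theta> :: real and k :: "nat \<Rightarrow> nat"
  assumes \<theta>: "0 < \<theta>"
  defines "k \<equiv> \<lambda>n. nat \<lfloor>\<theta> * real n powr (2 / 3)\<rfloor>"
begin

lemma tendsto_balls_scaled: "(\<lambda>n. real (k n) / real n powr (2 / 3)) \<longlonglongrightarrow> \<theta>"
  unfolding k_def by (rule tendsto_floor_scaled [OF \<theta>]) real_asymp

text \<open>With \<open>s n = n powr (2 / 3)\<close> the denominator \<open>n ^ 2\<close> is
  \<open>s n ^ 3\<close>, so each of the factors \<open>k\<close>, \<open>k - 1\<close>,
  \<open>k - 2\<close> is divided by one \<open>s n\<close>.\<close>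

lemma tendsto_mean_triples: "(\<lambda>n. real (k n choose 3) * (1 / real n ^ 2)) \<longlonglongrightarrow> \<theta> ^ 3 / 6"
proof -
  define s where "s n = real n powr (2 / 3)" for n
  have k: "(\<lambda>n. real (k n) / s n) \<longlonglongrightarrow> \<theta>"
    unfolding s_def by (rule tendsto_balls_scaled)
  have inv: "(\<lambda>n. c / s n) \<longlonglongrightarrow> 0" for c
    unfolding s_def by real_asymp
  have "(\<lambda>n. (real (k n) / s n) * (real (k n) / s n - 1 / s n) * (real (k n) / s n - 2 / s n) / 6)
      \<longlonglongrightarrow> \<theta> * (\<theta> - 0) * (\<theta> - 0) / 6"
    by (intro tendsto_intros k inv) auto
  then have "(\<lambda>n. (real (k n) / s n) * (real (k n) / s n - 1 / s n) * (real (k n) / s n - 2 / s n) / 6)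
      \<longlonglongrightarrow> \<theta> ^ 3 / 6"
    by (simp add: power3_eq_cube)
  moreover have "\<forall>\<^sub>F n in sequentially.
      (real (k n) / s n) * (real (k n) / s n - 1 / s n) * (real (k n) / s n - 2 / s n) / 6 =
      real (k n choose 3) * (1 / real n ^ 2)"
    using eventually_gt_at_top[of 0]
  proof eventually_elim
    case (elim n)
    have "s n ^ 3 = real n ^ 2"
      using elim by (simp add: s_def powr_power)
    moreover have "s n \<noteq> 0" using elim by (simp add: s_def)
    ultimately show ?case
      by (simp add: real_choose_3 power3_eq_cube flip: diff_divide_distrib)
  qed
  ultimately show ?thesis by (rule Lim_transform_eventually)
qed

text \<open>Factor out the fourth power of \<open>k n / n powr (2 / 3)\<close>, which converges;
  what is left equals \<open>n powr (- 1 / 3)\<close> for positive \<open>n\<close>.\<close>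

lemma tendsto_triples_error: "(\<lambda>n. real (k n) ^ 4 / real n ^ 3) \<longlonglongrightarrow> 0"
proof -
  have "(\<lambda>n. (real (k n) / real n powr (2 / 3)) ^ 4 * ((real n powr (2 / 3)) ^ 4 / real n ^ 3)) \<longlonglongrightarrow> \<theta> ^ 4 * 0"
  proof (intro tendsto_mult tendsto_power tendsto_balls_scaled)
    show "(\<lambda>n. (real n powr (2 / 3)) ^ 4 / real n ^ 3) \<longlonglongrightarrow> 0" by real_asymp
  qed
  then have "(\<lambda>n. (real (k n) / real n powr (2 / 3)) ^ 4 * ((real n powr (2 / 3)) ^ 4 / real n ^ 3)) \<longlonglongrightarrow> 0"
    by simp
  moreover have "\<forall>\<^sub>F n in sequentially.
      (real (k n) / real n powr (2 / 3)) ^ 4 * ((real n powr (2 / 3)) ^ 4 / real n ^ 3) = real (k n) ^ 4 / real n ^ 3"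
    using eventually_gt_at_top[of 0] by eventually_elim (simp add: power_divide)
  ultimately show ?thesis by (rule Lim_transform_eventually)
qed

end

theorem theorem8:
  shows "(\<exists>C::real. \<forall>k n::nat. 0 < k \<longrightarrow> 0 < n \<longrightarrow>
            tv_dist (measure_pmf (triples_law k n))
                    (measure_pmf (Poi (real (k choose 3) * (1 / real n ^ 2))))
              \<le> C * (real k ^ 4 / real n ^ 3))
       \<and> (\<forall>\<theta>::real. 0 < \<theta> \<longrightarrow>
            (let k = (\<lambda>n::nat. nat \<lfloor>\<theta> * real n powr (2 / 3)\<rfloor>) in
               (\<lambda>n. real (k n choose 3) * (1 / real n ^ 2)) \<longlonglongrightarrow> \<theta> ^ 3 / 6
             \<and> weak_conv_m (\<lambda>n. real_law (triples_law (k n) n)) (real_law (Poi (\<theta> ^ 3 / 6)))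
             \<and> (\<forall>m. Poi (\<theta> ^ 3 / 6) \<noteq> return_pmf m)))"
proof (intro conjI allI impI exI)
  fix k n :: nat
  assume "0 < n"
  then show "tv_dist (measure_pmf (triples_law k n))
      (measure_pmf (Poi (real (k choose 3) * (1 / real n ^ 2)))) \<le> 2624 * (real k ^ 4 / real n ^ 3)"
    by (rule tv_dist_triples_bound)
next
  fix \<theta> :: real
  assume \<theta>: "0 < \<theta>"
  define k where "k = (\<lambda>n::nat. nat \<lfloor>\<theta> * real n powr (2 / 3)\<rfloor>)"
  define r where "r n = real (k n choose 3) * (1 / real n ^ 2)" for n
  have mean: "r \<longlonglongrightarrow> \<theta> ^ 3 / 6"
    unfolding r_def k_def by (rule tendsto_mean_triples [OF \<theta>])
  have error: "(\<lambda>n. 2624 * (real (k n) ^ 4 / real n ^ 3)) \<longlonglongrightarrow> 0"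
    unfolding k_def by (rule tendsto_mult_right_zero [OF tendsto_triples_error [OF \<theta>]])
  have "weak_conv_m (\<lambda>n. real_law (triples_law (k n) n)) (real_law (Poi (\<theta> ^ 3 / 6)))"
  proof (rule weak_conv_m_real_lawI)
    fix A :: "nat set" assume A: "finite A"
    \<comment> \<open>The total variation bound makes the law of the count and the Poisson law of
      moving rate \<open>r n\<close> agree in the limit on \<open>A\<close>; continuity in the rate
      then replaces \<open>r n\<close> by its limit.\<close>
    have "(\<lambda>n. measure (triples_law (k n) n) A - measure (Poi (r n)) A) \<longlonglongrightarrow> 0"
    proof (rule Lim_null_comparison [OF _ error])
      show "\<forall>\<^sub>F n in sequentially. norm (measure (triples_law (k n) n) A - measure (Poi (r n)) A)
          \<le> 2624 * (real (k n) ^ 4 / real n ^ 3)"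
        using eventually_gt_at_top[of 0]
      proof eventually_elim
        case (elim n)
        then show ?case
          unfolding r_def real_norm_def
          by (intro order_trans [OF le_tv_dist_pmf tv_dist_triples_bound])
      qed
    qed
    moreover have "(\<lambda>n. measure (Poi (r n)) A) \<longlonglongrightarrow> measure (Poi (\<theta> ^ 3 / 6)) A"
      using mean \<theta> A by (intro tendsto_measure_Poi) auto
    ultimately show "(\<lambda>n. measure (triples_law (k n) n) A) \<longlonglongrightarrow> measure (Poi (\<theta> ^ 3 / 6)) A"
      by (rule Lim_transform [rotated])
  qed
  moreover have "Poi (\<theta> ^ 3 / 6) \<noteq> return_pmf m" for m
    using \<theta> by (intro Poi_neq_return_pmf) simp
  ultimately show "let k = \<lambda>n. nat \<lfloor>\<theta> * real n powr (2 / 3)\<rfloor> in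
      (\<lambda>n. real (k n choose 3) * (1 / real n ^ 2)) \<longlonglongrightarrow> \<theta> ^ 3 / 6 \<and>
      weak_conv_m (\<lambda>n. real_law (triples_law (k n) n)) (real_law (Poi (\<theta> ^ 3 / 6))) \<and>
      (\<forall>m. Poi (\<theta> ^ 3 / 6) \<noteq> return_pmf m)"
    using mean unfolding Let_def r_def k_def by blast
qed

end
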